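(* Let $X=(X_t)_{t\ge 0}$ be a real-valued additive process with $X_0=0$ satisfying $\mathbf{E}(e^{-\lambda X_t})<\infty$ for all $t\ge 0$ and all $\lambda\ge 0$. For $t\ge 0$ and $\lambda\ge 0$ put $\Phi(t;\lambda):=-\log \mathbf{E}(e^{-\lambda X_t})$, and for $0\le s\le t\le\infty$ and $n\in\{1,2,\dots\}$ put $m^{(n)}_{s,t}:=\mathbf{E}\Big(\big(\int_s^t e^{-X_u}\,du\big)^{n}\Big)\in[0,\infty]$. Then for all $0\le s\le t\le\infty$ and $n=1,2,\dots$, $$m^{(n)}_{s,t}=n!\int_s^{t}dt_1\int_{t_1}^{t}dt_2\cdots\int_{t_{n-1}}^{t}dt_n\,\exp\left(-\sum_{k=1}^{n}\left(\Phi(t_k;n-k+1)-\Phi(t_k;n-k)\right)\right).$$ In particular, $m^{(n)}_{s,\infty}<\infty$ if and only if the multiple integral on the right-hand side (with $t=\infty$) is finite.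
   Context: A real-valued additive process is a real-valued stochastic process $X=(X_t)_{t\ge0}$ with $X_0=0$ a.s., with independent increments (not necessarily stationary), with càdlàg sample paths, and continuous in probability. When $t=\infty$, the integrals are over $[s,\infty)$, $[t_1,\infty)$, etc., and both sides of the formula take values in $[0,\infty]$. *)

theory Defs
  imports "HOL-Probability.Probability"
begin

text \<open>
  Paths and processes are indexed by \<^typ>\<open>real\<close>; only the values at times \<open>t \<ge> 0\<close> are relevant.
\<close>

definition cadlag :: "(real \<Rightarrow> real) \<Rightarrow> bool" where
  "cadlag f \<longleftrightarrow>
    (\<forall>t\<ge>0. (f \<longlongrightarrow> f t) (at_right t)) \<and> (\<forall>t>0. \<exists>l. (f \<longlongrightarrow> l) (at_left t))"

locale additive_process = prob_space M for M :: "'a measure" +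
  fixes X :: "real \<Rightarrow> 'a \<Rightarrow> real"
  assumes random_variable_X: "\<And>t. 0 \<le> t \<Longrightarrow> random_variable borel (X t)"
    and start_zero: "AE \<omega> in M. X 0 \<omega> = 0"
    and indep_increments:
      "\<And>n (\<tau> :: nat \<Rightarrow> real). 0 \<le> \<tau> 0 \<Longrightarrow> (\<And>i. i < n \<Longrightarrow> \<tau> i < \<tau> (Suc i)) \<Longrightarrow>
         indep_vars (\<lambda>_. borel) (\<lambda>i \<omega>. X (\<tau> (Suc i)) \<omega> - X (\<tau> i) \<omega>) {..<n}"
    and cadlag_paths: "AE \<omega> in M. cadlag (\<lambda>t. X t \<omega>)"
    and continuous_in_probability:
      "\<And>t \<epsilon>. 0 \<le> t \<Longrightarrow> 0 < \<epsilon> \<Longrightarrow>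
         ((\<lambda>s. prob {\<omega> \<in> space M. \<bar>X s \<omega> - X t \<omega>\<bar> > \<epsilon>}) \<longlongrightarrow> 0) (at t within {0..})"

definition laplace_exponent :: "'a measure \<Rightarrow> (real \<Rightarrow> 'a \<Rightarrow> real) \<Rightarrow> real \<Rightarrow> real \<Rightarrow> real" where
  "laplace_exponent M X t q = - ln (\<integral>\<omega>. exp (- q * X t \<omega>) \<partial>M)"

text \<open>
  The finite times between two extended bounds: \<open>[s, t]\<close> for \<open>t < \<infinity>\<close>, \<open>[s, \<infinity>)\<close> for \<open>t = \<infinity>\<close>,
  and the empty set for \<open>s = t = \<infinity>\<close>.
\<close>

definition time_interval :: "ereal \<Rightarrow> ereal \<Rightarrow> real set" where
  "time_interval s t = {u. s \<le> ereal u \<and> ereal u \<le> t}"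

definition exp_functional_moment ::
  "'a measure \<Rightarrow> (real \<Rightarrow> 'a \<Rightarrow> real) \<Rightarrow> nat \<Rightarrow> ereal \<Rightarrow> ereal \<Rightarrow> ennreal" where
  "exp_functional_moment M X n s t =
    (\<integral>\<^sup>+ \<omega>. (\<integral>\<^sup>+ u \<in> time_interval s t. ennreal (exp (- X u \<omega>)) \<partial>lborel) ^ n \<partial>M)"

text \<open>
  Iterated integral over \<open>s \<le> t\<^sub>1 \<le> \<dots> \<le> t\<^sub>n \<le> t\<close>, integrating over \<open>t\<^sub>n\<close> innermost; the integrand takes
  the list \<open>[t\<^sub>1, \<dots>, t\<^sub>n]\<close>.
\<close>

fun iterated_integral :: "nat \<Rightarrow> ereal \<Rightarrow> ereal \<Rightarrow> (real list \<Rightarrow> ennreal) \<Rightarrow> ennreal" where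
  "iterated_integral 0 s t f = f []"
| "iterated_integral (Suc n) s t f =
    (\<integral>\<^sup>+ u \<in> time_interval s t.
       iterated_integral n (ereal u) t (\<lambda>us. f (u # us)) \<partial>lborel)"

text \<open>List positions start at 0, so the variable \<open>t\<^sub>k\<close> is \<open>ts ! (k - 1)\<close>.\<close>

definition multiple_integral ::
  "'a measure \<Rightarrow> (real \<Rightarrow> 'a \<Rightarrow> real) \<Rightarrow> nat \<Rightarrow> ereal \<Rightarrow> ereal \<Rightarrow> ennreal" where
  "multiple_integral M X n s t =
    iterated_integral n s t (\<lambda>ts. ennreal (exp (- (\<Sum>k=1..n.
        laplace_exponent M X (ts ! (k - 1)) (real (n - k + 1))
      - laplace_exponent M X (ts ! (k - 1)) (real (n - k))))))"

end

theory Submission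
  imports Defs
begin

text \<open>
  Pathwise, the \<open>n\<close>-th power of \<open>\<integral> e\<^bsup>-X\<^esup>\<close> over \<open>[s, t]\<close> is \<open>n!\<close> times the integral of
  \<open>e\<^bsup>-X(t\<^sub>1)\<^esup> \<dots> e\<^bsup>-X(t\<^sub>n)\<^esup>\<close> over the ordered simplex. Tonelli moves the expectation inside, and
  \<open>X(t\<^sub>1) + \<dots> + X(t\<^sub>n)\<close> is the sum of the independent increments \<open>X(t\<^sub>k) - X(t\<^sub>k\<^sub>-\<^sub>1)\<close>, \<open>t\<^sub>0 = 0\<close>,
  with weights \<open>n - k + 1\<close>. Independence also gives
  \<open>- log E exp (-q (X(t) - X(s))) = \<Phi>(t; q) - \<Phi>(s; q)\<close>, so the expectation of the product is
  explicit, and regrouping the exponent by time points yields the stated formula.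
\<close>

section \<open>Powers of an integral as ordered simplex integrals\<close>

lemma sets_time_interval [measurable, simp]: "time_interval s t \<in> sets borel"
  unfolding time_interval_def by measurable

text \<open>The simplex integral for a product integrand: each inner layer depends on the earlier
  times only through its lower bound, so induction on \<open>n\<close> can vary that bound alone. In
  contrast, \<open>iterated_integral\<close> carries the whole list of times.\<close>

primrec simplex_integral :: "(real \<Rightarrow> ennreal) \<Rightarrow> ereal \<Rightarrow> nat \<Rightarrow> ereal \<Rightarrow> ennreal" where
  "simplex_integral g t 0 s = 1"
| "simplex_integral g t (Suc n) s =
    (\<integral>\<^sup>+ u \<in> time_interval s t. g u * simplex_integral g t n (ereal u) \<partial>lborel)"

text \<open>The induction needs joint measurability, since the inner layer is evaluated at the
  integration variable \<open>v\<close> and at \<omega> together.\<close>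

lemma measurable_simplex_integral_param:
  fixes g :: "real \<Rightarrow> 'b \<Rightarrow> ennreal"
  assumes [measurable]: "case_prod g \<in> borel_measurable (borel \<Otimes>\<^sub>M N)"
  shows "(\<lambda>(u, \<omega>). simplex_integral (\<lambda>v. g v \<omega>) t n (ereal u)) \<in> borel_measurable (borel \<Otimes>\<^sub>M N)"
proof (induction n)
  case 0
  then show ?case by simp
next
  case (Suc n)
  note [measurable] = Suc
  \<comment> \<open>The domain of integration moves with the parameter; written as a condition on
    \<open>fst p\<close> and \<open>v\<close>, it is visibly jointly measurable.\<close>
  have "(\<lambda>p. \<integral>\<^sup>+ v. (if fst p \<le> v \<and> ereal v \<le> t
            then case_prod g (v, snd p) *
              (\<lambda>(u, \<omega>). simplex_integral (\<lambda>v. g v \<omega>) t n (ereal u)) (v, snd p)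
            else 0) \<partial>lborel) \<in> borel_measurable (borel \<Otimes>\<^sub>M N)"
    by measurable
  then show ?case
    by (rule measurable_cong[THEN iffD1, rotated])
      (auto simp: time_interval_def indicator_def intro!: nn_integral_cong)
qed

text \<open>The outermost lower bound may be infinite, so one layer is peeled off before the version
  with real bounds applies.\<close>

lemma measurable_simplex_integral_path:
  fixes g :: "real \<Rightarrow> 'b \<Rightarrow> ennreal"
  assumes [measurable]: "case_prod g \<in> borel_measurable (borel \<Otimes>\<^sub>M N)"
  shows "(\<lambda>\<omega>. simplex_integral (\<lambda>v. g v \<omega>) t n s) \<in> borel_measurable N"
proof (cases n)
  case (Suc m)
  note [measurable] = measurable_simplex_integral_param[OF assms, of t m]
  have "(\<lambda>\<omega>. \<integral>\<^sup>+ v. case_prod g (v, \<omega>) *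
      (\<lambda>(u, \<omega>). simplex_integral (\<lambda>v. g v \<omega>) t m (ereal u)) (v, \<omega>) *
      indicator (time_interval s t) v \<partial>lborel) \<in> borel_measurable N"
    by measurable
  then show ?thesis by (simp add: Suc)
qed simp

lemma measurable_simplex_integral [measurable]:
  assumes [measurable]: "g \<in> borel_measurable borel"
  shows "(\<lambda>u. simplex_integral g t n (ereal u)) \<in> borel_measurable borel"
proof -
  have "(\<lambda>(u, \<omega>::unit). simplex_integral (\<lambda>v. g v) t n (ereal u))
      \<in> borel_measurable (borel \<Otimes>\<^sub>M count_space UNIV)"
    by (rule measurable_simplex_integral_param) simp
  then have "(\<lambda>u. (\<lambda>(u, \<omega>::unit). simplex_integral g t n (ereal u)) (u, ()))
      \<in> borel_measurable borel"
    by (rule measurable_compose_rev) simp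
  then show ?thesis by simp
qed

text \<open>
  The extra variable \<open>v\<close> may fall before or after \<open>t\<^sub>1\<close>; the case \<open>v < t\<^sub>1\<close> gives the
  larger simplex directly, the case \<open>v \<ge> t\<^sub>1\<close> by induction. No subtraction or finiteness
  enters, so the identity holds in \<open>[0, \<infinity>]\<close>.
\<close>

lemma mult_simplex_integral:
  assumes [measurable]: "g \<in> borel_measurable borel"
  shows "(\<integral>\<^sup>+ v \<in> time_interval s t. g v \<partial>lborel) * simplex_integral g t n s =
    of_nat (Suc n) * simplex_integral g t (Suc n) s"
proof (induction n arbitrary: s)
  case 0
  then show ?case by simp
next
  case (Suc n)
  let ?I = "\<lambda>n u. simplex_integral g t n (ereal u)"
  let ?G = "\<lambda>s. \<integral>\<^sup>+ v \<in> time_interval s t. g v \<partial>lborel"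
  let ?B = "\<lambda>u. \<integral>\<^sup>+ v. g v * indicator (time_interval s t) v * indicator {..<u} v \<partial>lborel"
  \<comment> \<open>For \<open>u\<close> in the interval, \<open>[s, t]\<close> is cut into
    \<open>[s, u)\<close> and \<open>[u, t]\<close>.\<close>
  have split: "?G s = ?B u + ?G (ereal u)" if "u \<in> time_interval s t" for u
  proof -
    have "?B u + ?G (ereal u) =
        (\<integral>\<^sup>+ v. g v * indicator (time_interval s t) v * indicator {..<u} v
          + g v * indicator (time_interval (ereal u) t) v \<partial>lborel)"
      by (rule nn_integral_add[symmetric]) auto
    also have "\<dots> = ?G s"
      using that
      by (intro nn_integral_cong) (auto simp: time_interval_def indicator_def intro: order_trans)
    finally show ?thesis by simp
  qed
  \<comment> \<open>Tonelli makes the smaller variable \<open>v\<close> the outermost one;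
    \<open>u\<close> then runs over \<open>[v, t]\<close>, which produces one more layer of the
    simplex.\<close>
  have before: "(\<integral>\<^sup>+ u \<in> time_interval s t. g u * ?B u * ?I n u \<partial>lborel)
      = simplex_integral g t (Suc (Suc n)) s"
  proof -
    have "(\<integral>\<^sup>+ u \<in> time_interval s t. g u * ?B u * ?I n u \<partial>lborel) =
      (\<integral>\<^sup>+ u. (\<integral>\<^sup>+ v. (g u * ?I n u * indicator (time_interval s t) u)
        * (g v * indicator (time_interval s t) v * indicator {..<u} v) \<partial>lborel) \<partial>lborel)"
      by (subst nn_integral_cmult) (auto simp: ac_simps)
    also have "\<dots> = (\<integral>\<^sup>+ u. (\<integral>\<^sup>+ v. (if v < u then g u * ?I n u * indicator (time_interval s t) u
        * (g v * indicator (time_interval s t) v) else 0) \<partial>lborel) \<partial>lborel)"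
      by (intro nn_integral_cong) (auto simp: indicator_def)
    also have "\<dots> = (\<integral>\<^sup>+ v. (\<integral>\<^sup>+ u. (if v < u then g u * ?I n u * indicator (time_interval s t) u
        * (g v * indicator (time_interval s t) v) else 0) \<partial>lborel) \<partial>lborel)"
      by (rule lborel_pair.Fubini') measurable
    also have "\<dots> = (\<integral>\<^sup>+ v. (\<integral>\<^sup>+ u. (g v * indicator (time_interval s t) v) *
        (g u * ?I n u * indicator (time_interval (ereal v) t) u) \<partial>lborel) \<partial>lborel)"
    proof (rule nn_integral_cong, rule nn_integral_cong_AE)
      fix v :: real
      \<comment> \<open>The strict condition \<open>v < u\<close> and the closed interval starting
        at \<open>v\<close> disagree only at \<open>u = v\<close>.\<close>
      have "AE u in lborel. u \<noteq> v" by (rule AE_lborel_singleton)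
      then show "AE u in lborel. (if v < u then g u * ?I n u * indicator (time_interval s t) u
          * (g v * indicator (time_interval s t) v) else 0) =
          (g v * indicator (time_interval s t) v) *
          (g u * ?I n u * indicator (time_interval (ereal v) t) u)"
        by eventually_elim
          (auto simp: indicator_def time_interval_def ac_simps dest: order_trans less_imp_le
            intro: order_trans)
    qed
    also have "\<dots> = (\<integral>\<^sup>+ v. (g v * indicator (time_interval s t) v) * ?I (Suc n) v \<partial>lborel)"
      by (subst nn_integral_cmult) auto
    finally show ?thesis by (simp add: ac_simps)
  qed
  have "?G s * simplex_integral g t (Suc n) s =
      (\<integral>\<^sup>+ u. ?G s * (g u * ?I n u * indicator (time_interval s t) u) \<partial>lborel)"
    by (subst nn_integral_cmult) auto
  also have "\<dots> = (\<integral>\<^sup>+ u. g u * ?B u * ?I n u * indicator (time_interval s t) u +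
      of_nat (Suc n) * (g u * ?I (Suc n) u * indicator (time_interval s t) u) \<partial>lborel)"
  proof (rule nn_integral_cong)
    fix u :: real
    show "?G s * (g u * ?I n u * indicator (time_interval s t) u) =
      g u * ?B u * ?I n u * indicator (time_interval s t) u +
      of_nat (Suc n) * (g u * ?I (Suc n) u * indicator (time_interval s t) u)"
    proof (cases "u \<in> time_interval s t")
      case True
      have "?G s * (g u * ?I n u) = g u * ?B u * ?I n u + g u * (?G (ereal u) * ?I n u)"
        unfolding split[OF True] by (simp add: algebra_simps)
      \<comment> \<open>The part with \<open>v\<close> in \<open>[u, t]\<close> is the induction
        hypothesis at lower bound \<open>u\<close>.\<close>
      also have "?G (ereal u) * ?I n u = of_nat (Suc n) * ?I (Suc n) u"
        by (rule Suc.IH)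
      finally show ?thesis using True by (simp add: ac_simps del: simplex_integral.simps)
    qed simp
  qed
  also have "\<dots> = (\<integral>\<^sup>+ u \<in> time_interval s t. g u * ?B u * ?I n u \<partial>lborel) +
      of_nat (Suc n) * (\<integral>\<^sup>+ u \<in> time_interval s t. g u * ?I (Suc n) u \<partial>lborel)"
  proof -
    have [measurable]: "?B \<in> borel_measurable borel"
    proof -
      have "(\<lambda>u. \<integral>\<^sup>+ v. (if v < u then g v * indicator (time_interval s t) v else 0) \<partial>lborel)
          \<in> borel_measurable borel"
        by measurable
      also have "(\<lambda>u. \<integral>\<^sup>+ v. (if v < u then g v * indicator (time_interval s t) v else 0) \<partial>lborel) = ?B"
        by (intro ext nn_integral_cong) (auto simp: indicator_def)
      finally show ?thesis .
    qed
    note [simp del] = simplex_integral.simps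
    show ?thesis
      by (subst nn_integral_add) (auto simp: nn_integral_cmult)
  qed
  \<comment> \<open>One copy of the larger simplex comes from \<open>v < u\<close>, and
    \<open>Suc n\<close> copies from \<open>v\<close> in \<open>[u, t]\<close>.\<close>
  also have "\<dots> = of_nat (Suc (Suc n)) * simplex_integral g t (Suc (Suc n)) s"
    unfolding before by (simp add: algebra_simps)
  finally show ?case .
qed

text \<open>The factors \<open>Suc n\<close> gained with each new variable accumulate to
  \<open>fact n\<close>, the number of orderings of the times.\<close>

lemma nn_integral_power_eq_simplex_integral:
  assumes [measurable]: "g \<in> borel_measurable borel"
  shows "(\<integral>\<^sup>+ v \<in> time_interval s t. g v \<partial>lborel) ^ n = of_nat (fact n) * simplex_integral g t n s"
proof (induction n)
  case 0
  then show ?case by simp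
next
  case (Suc n)
  let ?G = "\<integral>\<^sup>+ v \<in> time_interval s t. g v \<partial>lborel"
  have "?G ^ Suc n = of_nat (fact n) * (?G * simplex_integral g t n s)"
    by (simp only: power_Suc Suc.IH mult.left_commute)
  also have "\<dots> = of_nat (fact (Suc n)) * simplex_integral g t (Suc n) s"
    unfolding mult_simplex_integral[OF assms] fact_Suc of_nat_mult of_nat_id by (simp only: ac_simps)
  finally show ?case .
qed

section \<open>Iterated integrals and summation by parts\<close>

text \<open>Independence of increments is available only along strictly increasing times. Coinciding
  times, and a first time equal to \<open>s\<close>, cost one null point per layer and can be
  ignored.\<close>

lemma iterated_integral_cong_strict:
  assumes "\<And>us. length us = n \<Longrightarrow> sorted_wrt (<) us \<Longrightarrow> \<forall>u\<in>set us. s < ereal u \<Longrightarrow> f us = g us"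
  shows "iterated_integral n s t f = iterated_integral n s t g"
  using assms
proof (induction n arbitrary: s f g)
  case 0
  then show ?case by simp
next
  case (Suc n)
  \<comment> \<open>For infinite \<open>s\<close> the claim is trivial, whatever value
    \<open>real_of_ereal s\<close> has.\<close>
  have "AE u in lborel. s \<noteq> ereal u"
    using AE_lborel_singleton[of "real_of_ereal s"] by eventually_elim auto
  then show ?case
    unfolding iterated_integral.simps
  proof (intro nn_integral_cong_AE, eventually_elim)
    case (elim u)
    show ?case
    proof (cases "u \<in> time_interval s t")
      case True
      then have "s < ereal u" using elim by (auto simp: time_interval_def)
      then have "iterated_integral n (ereal u) t (\<lambda>us. f (u # us)) =
          iterated_integral n (ereal u) t (\<lambda>us. g (u # us))"
        by (intro Suc.IH Suc.prems) (auto intro: less_trans)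
      then show ?thesis by simp
    qed simp
  qed
qed

text \<open>The weight \<open>W\<close> serves the induction: once Tonelli has moved the outermost
  integral outside, the factor \<open>g u\<close> is absorbed into it.\<close>

lemma (in sigma_finite_measure) nn_integral_mult_simplex_integral:
  fixes g :: "real \<Rightarrow> 'a \<Rightarrow> ennreal"
  assumes [measurable]: "case_prod g \<in> borel_measurable (borel \<Otimes>\<^sub>M M)"
    and "W \<in> borel_measurable M"
  shows "(\<integral>\<^sup>+ \<omega>. W \<omega> * simplex_integral (\<lambda>v. g v \<omega>) t n s \<partial>M) =
    iterated_integral n s t (\<lambda>us. \<integral>\<^sup>+ \<omega>. W \<omega> * (\<Prod>u\<leftarrow>us. g u \<omega>) \<partial>M)"
  using assms(2)
proof (induction n arbitrary: s W)
  case 0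
  then show ?case by simp
next
  case (Suc n)
  interpret P: pair_sigma_finite lborel M
    by standard
  note [measurable] = Suc.prems measurable_simplex_integral_param[OF assms(1), of t n]
  have [measurable]: "g u \<in> borel_measurable M" for u
    using measurable_compose[OF measurable_Pair1' assms(1), of u] by simp
  let ?J = "\<lambda>(u, \<omega>). simplex_integral (\<lambda>v. g v \<omega>) t n (ereal u)"
  have meas: "(\<lambda>(u, \<omega>). W \<omega> * (case_prod g (u, \<omega>) * ?J (u, \<omega>) * indicator (time_interval s t) u))
      \<in> borel_measurable (lborel \<Otimes>\<^sub>M M)"
    by measurable
  have sec: "(\<lambda>u. case_prod g (u, \<omega>) * ?J (u, \<omega>) * indicator (time_interval s t) u)
      \<in> borel_measurable lborel" if [measurable]: "\<omega> \<in> space M" for \<omega>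
    by measurable
  have "(\<integral>\<^sup>+ \<omega>. W \<omega> * simplex_integral (\<lambda>v. g v \<omega>) t (Suc n) s \<partial>M) =
     (\<integral>\<^sup>+ \<omega>. (\<integral>\<^sup>+ u. W \<omega> * (case_prod g (u, \<omega>) * ?J (u, \<omega>) * indicator (time_interval s t) u)
        \<partial>lborel) \<partial>M)"
    by (intro nn_integral_cong, subst nn_integral_cmult[OF sec]) auto
  also have "\<dots> = (\<integral>\<^sup>+ u. (\<integral>\<^sup>+ \<omega>. W \<omega> * (case_prod g (u, \<omega>) * ?J (u, \<omega>) *
        indicator (time_interval s t) u) \<partial>M) \<partial>lborel)"
    by (rule P.Fubini'[OF meas])
  also have "\<dots> = (\<integral>\<^sup>+ u \<in> time_interval s t.
      (\<integral>\<^sup>+ \<omega>. (W \<omega> * g u \<omega>) * simplex_integral (\<lambda>v. g v \<omega>) t n (ereal u) \<partial>M) \<partial>lborel)"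
    by (intro nn_integral_cong) (auto simp: indicator_def ac_simps)
  also have "\<dots> = iterated_integral (Suc n) s t (\<lambda>us. \<integral>\<^sup>+ \<omega>. W \<omega> * (\<Prod>u\<leftarrow>us. g u \<omega>) \<partial>M)"
    by (subst Suc.IH) (auto simp: ac_simps)
  finally show ?case .
qed

text \<open>The increment from \<open>x i\<close> to \<open>x (Suc i)\<close> is contained in each
  of \<open>x (Suc i)\<close>, ..., \<open>x n\<close>, hence counted \<open>n - i\<close>
  times.\<close>

lemma sum_eq_weighted_increments:
  fixes x :: "nat \<Rightarrow> real"
  assumes "x 0 = 0"
  shows "(\<Sum>i<n. real (n - i) * (x (Suc i) - x i)) = (\<Sum>i<n. x (Suc i))"
proof (induction n)
  case 0
  then show ?case by simp
next
  case (Suc n)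
  have "(\<Sum>i<Suc n. real (Suc n - i) * (x (Suc i) - x i)) =
      (\<Sum>i<Suc n. real (n - i) * (x (Suc i) - x i) + (x (Suc i) - x i))"
    \<comment> \<open>Passing to \<open>Suc n\<close> raises every weight by one; the old weight at
      \<open>i = n\<close> is 0, and the added increments telescope.\<close>
    by (intro sum.cong) (auto simp: Suc_diff_le algebra_simps)
  also have "\<dots> = (\<Sum>i<n. real (n - i) * (x (Suc i) - x i)) + (\<Sum>i<Suc n. x (Suc i) - x i)"
    by (simp add: sum.distrib)
  also have "(\<Sum>i<Suc n. x (Suc i) - x i) = x (Suc n)"
    using assms by (subst sum_lessThan_telescope) simp
  finally show ?case using Suc by simp
qed

section \<open>Laplace exponents and a jointly measurable version\<close>

context additive_process
begin

lemma laplace_exponent_zero_time: "laplace_exponent M X 0 q = 0"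
proof -
  have [measurable]: "X 0 \<in> borel_measurable M"
    by (rule random_variable_X) simp
  have "(\<integral>\<omega>. exp (- q * X 0 \<omega>) \<partial>M) = (\<integral>\<omega>. 1 \<partial>M)"
    using start_zero by (intro integral_cong_AE) auto
  then show ?thesis by (simp add: laplace_exponent_def prob_space)
qed

lemma laplace_exponent_zero: "laplace_exponent M X t 0 = 0"
  by (simp add: laplace_exponent_def prob_space)

text \<open>
  The paths are only almost surely right-continuous, so \<open>X\<close> itself need not be jointly
  measurable.
\<close>

lemma jointly_measurable_version:
  obtains Y where "case_prod Y \<in> borel_measurable (borel \<Otimes>\<^sub>M M)"
    and "AE \<omega> in M. \<forall>t\<ge>0. Y t \<omega> = X t \<omega>"
proof -
  \<comment> \<open>The set of bad paths need not be measurable, so it is enlarged to a null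
    set.\<close>
  obtain N where N: "{\<omega> \<in> space M. \<not> cadlag (\<lambda>t. X t \<omega>)} \<subseteq> N" "N \<in> null_sets M"
    using cadlag_paths by (auto elim!: AE_E simp: null_sets_def)
  have [measurable]: "N \<in> sets M" using N(2) by auto
  define Y where "Y t \<omega> = (if \<omega> \<in> N then 0 else X (max 0 t) \<omega>)" for t \<omega>
  \<comment> \<open>\<open>d k i\<close> is the right endpoint of the \<open>i\<close>-th cell of
    mesh \<open>1 / Suc k\<close>; clipping at 0 makes it a legitimate time for every integer
    \<open>i\<close>.\<close>
  define d :: "nat \<Rightarrow> int \<Rightarrow> real" where "d k i = (max 0 (of_int i) + 1) / real (Suc k)" for k i
  define Z where "Z k p = (if snd p \<in> N then 0
      else X (d k \<lfloor>real (Suc k) * max 0 (fst p)\<rfloor>) (snd p))" for k and p :: "real \<times> 'a"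
  have Z [measurable]: "Z k \<in> borel_measurable (borel \<Otimes>\<^sub>M M)" for k
  proof -
    \<comment> \<open>For a fixed cell only one random variable is involved, and there are countably
      many cells.\<close>
    have "(\<lambda>p. (\<lambda>i p. if snd p \<in> N then 0 else X (d k i) (snd p))
        ((\<lambda>p. \<lfloor>real (Suc k) * max 0 (fst p)\<rfloor>) p) p) \<in> borel_measurable (borel \<Otimes>\<^sub>M M)"
    proof (rule measurable_compose_countable)
      fix i
      have [measurable]: "X (d k i) \<in> borel_measurable M"
        by (rule random_variable_X) (simp add: d_def)
      show "(\<lambda>p. if snd p \<in> N then 0 else X (d k i) (snd p)) \<in> borel_measurable (borel \<Otimes>\<^sub>M M)"
        by measurable
    qed measurable
    then show ?thesis by (simp add: Z_def[abs_def])
  qed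
  have lim: "(\<lambda>k. Z k p) \<longlonglongrightarrow> case_prod Y p" if "p \<in> space (borel \<Otimes>\<^sub>M M)" for p
  proof (cases "snd p \<in> N")
    case True
    then show ?thesis by (simp add: Z_def Y_def split_beta)
  next
    case False
    define t where "t = max 0 (fst p)"
    have t: "0 \<le> t" by (simp add: t_def)
    let ?e = "\<lambda>k. d k \<lfloor>real (Suc k) * t\<rfloor>"
    \<comment> \<open>Approach must be strictly from the right, as \<open>at_right t\<close>
      excludes \<open>t\<close>.\<close>
    have e: "t < ?e k" "?e k \<le> t + 1 / real (Suc k)" for k
    proof -
      have *: "max 0 (of_int \<lfloor>real (Suc k) * t\<rfloor>) = (of_int \<lfloor>real (Suc k) * t\<rfloor> :: real)"
        using t by (simp add: max_def)
      show "t < ?e k" "?e k \<le> t + 1 / real (Suc k)"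
        unfolding d_def * using floor_correct[of "real (Suc k) * t"]
        by (simp_all add: field_simps del: of_nat_Suc)
    qed
    have "(\<lambda>k. t + 1 / real (Suc k)) \<longlonglongrightarrow> t + 0"
      by (intro tendsto_intros LIMSEQ_Suc lim_1_over_n)
    then have "?e \<longlonglongrightarrow> t"
      by (intro tendsto_sandwich[of "\<lambda>_. t" ?e _ "\<lambda>k. t + 1 / real (Suc k)"])
        (use e in \<open>auto intro!: always_eventually intro: less_imp_le\<close>)
    then have fl: "filterlim ?e (at_right t) sequentially"
      using e(1) less_imp_neq[OF e(1)] by (simp add: filterlim_at always_eventually not_sym del: of_nat_Suc)
    have "cadlag (\<lambda>t. X t (snd p))"
      using False N(1) that by (auto simp: space_pair_measure)
    then have "((\<lambda>t. X t (snd p)) \<longlongrightarrow> X t (snd p)) (at_right t)"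
      using t by (auto simp: cadlag_def)
    from filterlim_compose[OF this fl] show ?thesis
      using False by (simp add: Z_def Y_def t_def split_beta)
  qed
  have "case_prod Y \<in> borel_measurable (borel \<Otimes>\<^sub>M M)"
    by (rule borel_measurable_LIMSEQ_real[OF lim Z])
  moreover have "AE \<omega> in M. \<forall>t\<ge>0. Y t \<omega> = X t \<omega>"
    using AE_not_in[OF N(2)] by eventually_elim (auto simp: Y_def max_def)
  ultimately show ?thesis by (rule that)
qed

section \<open>Exponential moments of increments and the moment formula\<close>

context
  assumes exp_integrable: "\<And>t q. 0 \<le> t \<Longrightarrow> 0 \<le> q \<Longrightarrow> integrable M (\<lambda>\<omega>. exp (- q * X t \<omega>))"
begin

lemma nn_integral_exp_eq:
  assumes "0 \<le> t" "0 \<le> q"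
  shows "(\<integral>\<^sup>+ \<omega>. ennreal (exp (- q * X t \<omega>)) \<partial>M) = ennreal (exp (- laplace_exponent M X t q))"
proof -
  \<comment> \<open>A strictly positive integrand cannot have integral 0 under a probability
    measure; positivity lets \<open>exp\<close> undo \<open>ln\<close>.\<close>
  have "0 < (\<integral>\<omega>. exp (- q * X t \<omega>) \<partial>M)"
    using integral_nonneg_eq_0_iff_AE[OF exp_integrable[OF assms]]
    by (simp add: less_le)
  then show ?thesis
    by (subst nn_integral_eq_integral[OF exp_integrable[OF assms]])
      (simp_all add: laplace_exponent_def)
qed

text \<open>\<open>X t\<close> is the sum of the independent increments over \<open>[0, s]\<close>
  and \<open>[s, t]\<close>, so its exponential moment factors and the first factor can be divided
  out.\<close>

lemma nn_integral_exp_increment: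
  assumes "0 \<le> s" "s < t" "0 \<le> q"
  shows "(\<integral>\<^sup>+ \<omega>. ennreal (exp (- q * (X t \<omega> - X s \<omega>))) \<partial>M) =
    ennreal (exp (- (laplace_exponent M X t q - laplace_exponent M X s q)))" (is "?D = _")
\<comment> \<open>The grid 0, \<open>s\<close>, \<open>t\<close> is strictly increasing only for
  positive \<open>s\<close>.\<close>
proof (cases "s = 0")
  case True
  have "?D = (\<integral>\<^sup>+ \<omega>. ennreal (exp (- q * X t \<omega>)) \<partial>M)"
    using start_zero True by (intro nn_integral_cong_AE) auto
  then show ?thesis
    using assms nn_integral_exp_eq[of t q] by (simp add: laplace_exponent_zero_time True)
next
  case False
  define \<tau> :: "nat \<Rightarrow> real" where "\<tau> i = (if i = 0 then 0 else if i = 1 then s else t)" for i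
  have iv: "indep_vars (\<lambda>_. borel) (\<lambda>i \<omega>. X (\<tau> (Suc i)) \<omega> - X (\<tau> i) \<omega>) {..<2}"
    using assms False by (intro indep_increments) (auto simp: \<tau>_def)
  have "(\<integral>\<^sup>+ \<omega>. (\<Prod>i\<in>{..<2}. ennreal (exp (- q * (X (\<tau> (Suc i)) \<omega> - X (\<tau> i) \<omega>)))) \<partial>M) =
     (\<Prod>i\<in>{..<2}. \<integral>\<^sup>+ \<omega>. ennreal (exp (- q * (X (\<tau> (Suc i)) \<omega> - X (\<tau> i) \<omega>))) \<partial>M)"
    by (rule indep_vars_nn_integral) (auto intro!: indep_vars_compose2[OF iv])
  also have "\<dots> = (\<integral>\<^sup>+ \<omega>. ennreal (exp (- q * (X s \<omega> - X 0 \<omega>))) \<partial>M) * ?D"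
    by (simp add: \<tau>_def numeral_2_eq_2 lessThan_Suc mult.commute)
  also have "(\<integral>\<^sup>+ \<omega>. ennreal (exp (- q * (X s \<omega> - X 0 \<omega>))) \<partial>M) =
      (\<integral>\<^sup>+ \<omega>. ennreal (exp (- q * X s \<omega>)) \<partial>M)"
    using start_zero by (intro nn_integral_cong_AE) auto
  also have "(\<integral>\<^sup>+ \<omega>. (\<Prod>i\<in>{..<2}. ennreal (exp (- q * (X (\<tau> (Suc i)) \<omega> - X (\<tau> i) \<omega>)))) \<partial>M) =
      (\<integral>\<^sup>+ \<omega>. ennreal (exp (- q * X t \<omega>)) \<partial>M)"
    using start_zero
  proof (intro nn_integral_cong_AE, eventually_elim)
    case (elim \<omega>)
    then show ?case
      by (simp add: \<tau>_def numeral_2_eq_2 lessThan_Suc ennreal_mult[symmetric] exp_add[symmetric]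
          algebra_simps)
  qed
  finally have eq: "ennreal (exp (- laplace_exponent M X t q)) =
      ennreal (exp (- laplace_exponent M X s q)) * ?D"
    using assms by (simp only: nn_integral_exp_eq less_imp_le order_trans[OF assms(1) less_imp_le])
  \<comment> \<open>Division is done by multiplying with the finite reciprocal, which is sound even
    before \<open>?D\<close> is known to be finite.\<close>
  have "?D = ennreal (exp (laplace_exponent M X s q)) *
      (ennreal (exp (- laplace_exponent M X s q)) * ?D)"
    by (simp add: mult.assoc[symmetric] ennreal_mult[symmetric] exp_add[symmetric])
  also have "\<dots> = ennreal (exp (- (laplace_exponent M X t q - laplace_exponent M X s q)))"
    unfolding eq[symmetric] by (simp add: ennreal_mult[symmetric] exp_add[symmetric])
  finally show ?thesis .
qed

lemma nn_integral_prod_exp: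
  assumes "length us = n" "sorted_wrt (<) us" "\<forall>u\<in>set us. 0 < u"
  shows "(\<integral>\<^sup>+ \<omega>. (\<Prod>u\<leftarrow>us. ennreal (exp (- X u \<omega>))) \<partial>M) =
    ennreal (exp (- (\<Sum>k=1..n. laplace_exponent M X (us ! (k - 1)) (real (n - k + 1))
      - laplace_exponent M X (us ! (k - 1)) (real (n - k)))))"
proof -
  let ?\<Phi> = "laplace_exponent M X"
  \<comment> \<open>Prepending time 0 makes every \<open>X (us ! i)\<close> a sum of increments;
    positivity of the times makes the first step strict.\<close>
  define \<tau> where "\<tau> i = (0 # us) ! i" for i
  have \<tau>0: "\<tau> 0 = 0" and \<tau>Suc: "\<tau> (Suc i) = us ! i" for i by (simp_all add: \<tau>_def)
  have mono: "\<tau> i < \<tau> (Suc i)" if "i < n" for i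
    using that assms sorted_wrt_nth_less[of "(<)" "0 # us" i "Suc i"] by (simp add: \<tau>_def)
  have nonneg: "0 \<le> \<tau> i" if "i \<le> n" for i
    using that assms by (cases i) (auto simp: \<tau>0 \<tau>Suc intro!: less_imp_le)
  have iv: "indep_vars (\<lambda>_. borel) (\<lambda>i \<omega>. X (\<tau> (Suc i)) \<omega> - X (\<tau> i) \<omega>) {..<n}"
    using mono by (intro indep_increments) (auto simp: \<tau>0)
  have "(\<integral>\<^sup>+ \<omega>. (\<Prod>u\<leftarrow>us. ennreal (exp (- X u \<omega>))) \<partial>M) =
      (\<integral>\<^sup>+ \<omega>. (\<Prod>i\<in>{..<n}. ennreal (exp (- real (n - i) * (X (\<tau> (Suc i)) \<omega> - X (\<tau> i) \<omega>)))) \<partial>M)"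
    using start_zero
  proof (intro nn_integral_cong_AE, eventually_elim)
    case (elim \<omega>)
    have "(\<Prod>u\<leftarrow>us. ennreal (exp (- X u \<omega>))) = (\<Prod>i<n. ennreal (exp (- X (us ! i) \<omega>)))"
      using assms(1) by (subst prod.list_conv_set_nth) (simp add: atLeast0LessThan)
    also have "\<dots> = ennreal (exp (- (\<Sum>i<n. X (\<tau> (Suc i)) \<omega>)))"
      by (simp add: prod_ennreal exp_sum[symmetric] sum_negf \<tau>Suc)
    also have "(\<Sum>i<n. X (\<tau> (Suc i)) \<omega>) =
        (\<Sum>i<n. real (n - i) * (X (\<tau> (Suc i)) \<omega> - X (\<tau> i) \<omega>))"
      using elim by (subst sum_eq_weighted_increments[of "\<lambda>i. X (\<tau> i) \<omega>"]) (auto simp: \<tau>0)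
    finally show ?case
      by (simp add: prod_ennreal exp_sum[symmetric] sum_negf[symmetric] algebra_simps
          del: of_nat_diff of_nat_diff_if)
  qed
  also have "\<dots> = (\<Prod>i\<in>{..<n}.
      \<integral>\<^sup>+ \<omega>. ennreal (exp (- real (n - i) * (X (\<tau> (Suc i)) \<omega> - X (\<tau> i) \<omega>))) \<partial>M)"
    by (rule indep_vars_nn_integral) (auto intro!: indep_vars_compose2[OF iv])
  also have "\<dots> = (\<Prod>i\<in>{..<n}.
      ennreal (exp (- (?\<Phi> (\<tau> (Suc i)) (real (n - i)) - ?\<Phi> (\<tau> i) (real (n - i))))))"
    using mono nonneg by (intro prod.cong refl nn_integral_exp_increment) auto
  also have "\<dots> = ennreal (exp (- (\<Sum>i<n. ?\<Phi> (\<tau> (Suc i)) (real (n - i)) - ?\<Phi> (\<tau> i) (real (n - i)))))"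
    by (simp add: prod_ennreal exp_sum[symmetric] sum_negf[symmetric])
  also have "(\<Sum>i<n. ?\<Phi> (\<tau> (Suc i)) (real (n - i)) - ?\<Phi> (\<tau> i) (real (n - i))) =
      (\<Sum>i<n. ?\<Phi> (\<tau> (Suc i)) (real (n - i)) - ?\<Phi> (\<tau> (Suc i)) (real (n - Suc i)))"
  proof -
    \<comment> \<open>The two groupings differ by a telescoping sum, whose end terms vanish because
      one has argument 0 and the other time 0.\<close>
    have "(\<Sum>i<n. ?\<Phi> (\<tau> (Suc i)) (real (n - Suc i)) - ?\<Phi> (\<tau> i) (real (n - i))) =
        ?\<Phi> (\<tau> n) (real (n - n)) - ?\<Phi> (\<tau> 0) (real (n - 0))"
      by (rule sum_lessThan_telescope)
    then show ?thesis
      by (simp add: laplace_exponent_zero laplace_exponent_zero_time \<tau>0 sum_subtractf)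
  qed
  also have "\<dots> = (\<Sum>k=1..n. ?\<Phi> (us ! (k - 1)) (real (n - k + 1)) - ?\<Phi> (us ! (k - 1)) (real (n - k)))"
  proof -
    have "{1..n} = Suc ` {..<n}" by (simp add: image_Suc_lessThan)
    then show ?thesis
      by (simp add: sum.reindex \<tau>Suc Suc_diff_Suc flip: of_nat_Suc)
  qed
  finally show ?thesis .
qed

lemma exp_functional_moment_eq:
  assumes "0 \<le> s"
  shows "exp_functional_moment M X n s t = ennreal (fact n) * multiple_integral M X n s t"
proof -
  obtain Y where Y [measurable]: "case_prod Y \<in> borel_measurable (borel \<Otimes>\<^sub>M M)"
    and XY: "AE \<omega> in M. \<forall>t\<ge>0. Y t \<omega> = X t \<omega>"
    by (rule jointly_measurable_version)
  define g where "g u \<omega> = ennreal (exp (- Y u \<omega>))" for u \<omega>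
  have g: "case_prod g \<in> borel_measurable (borel \<Otimes>\<^sub>M M)"
    unfolding g_def by measurable
  have sec: "(\<lambda>u. g u \<omega>) \<in> borel_measurable borel" if "\<omega> \<in> space M" for \<omega>
    using measurable_compose[OF measurable_Pair2'[OF that] g] by simp
  \<comment> \<open>\<open>Y\<close> agrees with \<open>X\<close> only at nonnegative times.\<close>
  have nonneg: "0 \<le> u" if "u \<in> time_interval s t" for u
    using that assms order_trans[of 0 s "ereal u"] by (auto simp: time_interval_def)
  have "exp_functional_moment M X n s t =
      (\<integral>\<^sup>+ \<omega>. (\<integral>\<^sup>+ u \<in> time_interval s t. g u \<omega> \<partial>lborel) ^ n \<partial>M)"
    unfolding exp_functional_moment_def using XY
  proof (intro nn_integral_cong_AE, eventually_elim)
    case (elim \<omega>)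
    then have "(\<integral>\<^sup>+ u \<in> time_interval s t. ennreal (exp (- X u \<omega>)) \<partial>lborel) =
        (\<integral>\<^sup>+ u \<in> time_interval s t. g u \<omega> \<partial>lborel)"
      by (intro nn_integral_cong) (auto simp: g_def indicator_def dest: nonneg)
    then show ?case by simp
  qed
  also have "\<dots> = (\<integral>\<^sup>+ \<omega>. of_nat (fact n) * simplex_integral (\<lambda>u. g u \<omega>) t n s \<partial>M)"
    by (intro nn_integral_cong nn_integral_power_eq_simplex_integral sec)
  also have "\<dots> = ennreal (fact n) *
      (\<integral>\<^sup>+ \<omega>. 1 * simplex_integral (\<lambda>u. g u \<omega>) t n s \<partial>M)"
    by (subst nn_integral_cmult[OF measurable_simplex_integral_path[OF g]])
      (simp add: ennreal_of_nat_eq_real_of_nat)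
  also have "(\<integral>\<^sup>+ \<omega>. 1 * simplex_integral (\<lambda>u. g u \<omega>) t n s \<partial>M) =
      iterated_integral n s t (\<lambda>us. \<integral>\<^sup>+ \<omega>. 1 * (\<Prod>u\<leftarrow>us. g u \<omega>) \<partial>M)"
    by (rule nn_integral_mult_simplex_integral[OF g]) simp
  also have "\<dots> = multiple_integral M X n s t"
    unfolding multiple_integral_def
  proof (rule iterated_integral_cong_strict)
    fix us :: "real list"
    assume us: "length us = n" "sorted_wrt (<) us" "\<forall>u\<in>set us. s < ereal u"
    have pos: "\<forall>u\<in>set us. 0 < u"
    proof
      fix u assume "u \<in> set us"
      then have "0 < ereal u" using us(3) le_less_trans[OF assms] by blast
      then show "0 < u" by simp
    qed
    \<comment> \<open>With Tonelli done, joint measurability has served its purpose;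
      \<open>X\<close> returns because the independence is stated for it.\<close>
    have "(\<integral>\<^sup>+ \<omega>. 1 * (\<Prod>u\<leftarrow>us. g u \<omega>) \<partial>M) =
        (\<integral>\<^sup>+ \<omega>. (\<Prod>u\<leftarrow>us. ennreal (exp (- X u \<omega>))) \<partial>M)"
      using XY
    proof (intro nn_integral_cong_AE, eventually_elim)
      case (elim \<omega>)
      then have "map (\<lambda>u. g u \<omega>) us = map (\<lambda>u. ennreal (exp (- X u \<omega>))) us"
        using pos by (auto simp: g_def)
      then show ?case by (simp only: mult_1_left)
    qed
    then show "(\<integral>\<^sup>+ \<omega>. 1 * (\<Prod>u\<leftarrow>us. g u \<omega>) \<partial>M) =
        ennreal (exp (- (\<Sum>k=1..n. laplace_exponent M X (us ! (k - 1)) (real (n - k + 1))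
          - laplace_exponent M X (us ! (k - 1)) (real (n - k)))))"
      using nn_integral_prod_exp[OF us(1,2) pos] by simp
  qed
  finally show ?thesis .
qed

end

end

theorem proposition2p5:
  fixes M :: "'a measure" and X :: "real \<Rightarrow> 'a \<Rightarrow> real"
  assumes "additive_process M X"
    and "\<And>t q. 0 \<le> t \<Longrightarrow> 0 \<le> q \<Longrightarrow> integrable M (\<lambda>\<omega>. exp (- q * X t \<omega>))"
  shows "(\<forall>(s::ereal) (t::ereal) n. 0 \<le> s \<longrightarrow> s \<le> t \<longrightarrow> 1 \<le> n \<longrightarrow>
      exp_functional_moment M X n s t = ennreal (fact n) * multiple_integral M X n s t) \<and>
    (\<forall>(s::ereal) n. 0 \<le> s \<longrightarrow> 1 \<le> n \<longrightarrow>
      (exp_functional_moment M X n s \<infinity> < \<infinity> \<longleftrightarrow> multiple_integral M X n s \<infinity> < \<infinity>))"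
proof -
  interpret additive_process M X by fact
  note eq = exp_functional_moment_eq[OF assms(2)]
  show ?thesis
    \<comment> \<open>The factor \<open>fact n\<close> is finite and nonzero, so it preserves
      finiteness both ways.\<close>
    by (auto simp: eq ennreal_mult_less_top)
qed

end
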